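(* Let $V:[0,\infty)\to\mathbb{R}\cup\{+\infty\}$ be given by $V(r)=+\infty$ for $r\in[0,1)$, $V(r)=-1$ for $r\in[1,\sqrt2]$, and $V(r)=0$ for $r>\sqrt2$. Then $$N\,\overline{\mathcal E}_{\mathrm{sq}}[V]\le \mathcal E[V](N)\le N\,\overline{\mathcal E}_{\mathrm{sq}}[V]+O(N^{1/2})\qquad\text{as }N\to+\infty,$$ where $\overline{\mathcal E}_{\mathrm{sq}}[V]=-4$.
   Context: For a finite set $X_N=\{x_1,\dots,x_N\}\subset\mathbb{R}^2$ of $N$ distinct points, $\mathcal E[V](X_N):=\frac12\sum_{i\ne j}V(|x_i-x_j|)$. The ground state energy is $\mathcal E[V](N):=\min\{\mathcal E[V](X_N): X_N\subset\mathbb{R}^2,\ \sharp X_N=N\}$. The minimal energy per point among square lattices is $$\overline{\mathcal E}_{\mathrm{sq}}[V]:=\min_{t>0}\lim_{R\to\infty}\frac{\mathcal E[V](t\mathbb{Z}^2\cap B_R)}{\sharp(t\mathbb{Z}^2\cap B_R)},$$ where $B_R$ is the open ball of radius $R$ centered at $0$. $O(N^{1/2})$ denotes a quantity bounded in absolute value by a constant times $N^{1/2}$ for large $N$. The first inequality is for every $N\in\mathbb{N}$. *)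

theory Defs
  imports "HOL-Analysis.Analysis" "HOL-Library.Landau_Symbols"
begin

text \<open>
  Potentials are functions on \<^typ>\<open>real\<close> of which only the values on the nonnegative
  half-line are ever used. Values live in \<^typ>\<open>ereal\<close>; the potentials of interest never
  take the value minus infinity, so no undetermined sums arise.
\<close>

definition energy :: "(real \<Rightarrow> ereal) \<Rightarrow> (real^2) set \<Rightarrow> ereal" where
  "energy V X = ereal (1/2) * (\<Sum>x\<in>X. \<Sum>y\<in>X - {x}. V (norm (x - y)))"

definition ground_energy :: "(real \<Rightarrow> ereal) \<Rightarrow> nat \<Rightarrow> ereal" where
  "ground_energy V N = (INF X\<in>{X. finite X \<and> card X = N}. energy V X)"

definition square_lattice :: "real \<Rightarrow> (real^2) set" where
  "square_lattice t = (\<lambda>x. t *\<^sub>R x) ` {x. \<forall>i. x $ i \<in> \<int>}"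

definition lattice_mean_energy :: "(real \<Rightarrow> ereal) \<Rightarrow> real \<Rightarrow> real \<Rightarrow> ereal" where
  "lattice_mean_energy V t R =
     energy V (square_lattice t \<inter> ball 0 R) / ereal (real (card (square_lattice t \<inter> ball 0 R)))"

definition lattice_energy :: "(real \<Rightarrow> ereal) \<Rightarrow> real \<Rightarrow> ereal" where
  "lattice_energy V t = Lim at_top (lattice_mean_energy V t)"

text \<open>
  The minima defining \<^const>\<open>ground_energy\<close> and the energy below are rendered as infima, and
  the limit in \<^const>\<open>lattice_energy\<close> is meaningful only where it exists; attainment and
  convergence have to be asserted separately.
\<close>

definition sq_energy :: "(real \<Rightarrow> ereal) \<Rightarrow> ereal" where
  "sq_energy V = (INF t\<in>{0<..}. lattice_energy V t)"

definition sticky_potential :: "real \<Rightarrow> ereal" where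
  "sticky_potential r = (if r < 1 then \<infinity> else if r \<le> sqrt 2 then -1 else 0)"

end

theory Submission
  imports Defs "HOL-Real_Asymp.Real_Asymp"
begin

text \<open>
  A configuration has infinite energy as soon as two of its points are closer than 1; otherwise
  its energy is minus the number of bonds, the pairs at distance at most \<open>sqrt 2\<close>. So the energy
  is minus half the sum of the degrees in the bond graph, and everything is a question
  about degrees.

  The bound from below is local: no point has more than eight neighbours. Seen from the point, the
  neighbours lie in the annulus with radii 1 and \<open>sqrt 2\<close>, and by the law of cosines two points
  of this annulus at mutual distance at least 1 are seen under an angle whose cosine is at most
  \<open>3/4\<close>. As \<open>cos (2 * pi / 9) > 3/4\<close> (lemma \<open>cos_gt_three_quarters\<close>), these angles exceed 40
  degrees, and nine of them do not fit around the point (\<open>card_annulus_le_8_complex\<close>).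
  Hence every configuration of \<open>N\<close> points has energy at least \<open>- 4 N\<close>. The same count shows that
  only finitely many energies occur for given \<open>N\<close>, so the infimum is attained.

  The bound from above counts the bonds that a lattice configuration loses at its boundary. For
  spacing \<open>t \<ge> 1\<close>, bonds of the square lattice run in a set of at most eight
  directions, all of them with coordinates in \<open>{-1, 0, 1}\<close>, and exactly eight for \<open>t = 1\<close>.
  If the configuration is cut out by a convex set, then a lattice line in direction \<open>d\<close> leaves it
  at most once, so the number of points whose bond in direction \<open>d\<close> is lost is at most the number
  of lattice lines in this direction that meet the set, which is linear in the diameter
  (\<open>card_exits_le\<close>). For a disc of radius \<open>R\<close> this loss is \<open>O(R)\<close> against at least \<open>c R\<^sup>2\<close>
  points, so the mean energy tends to minus half the number of directions.
  For \<open>t < 1\<close> the energy is infinite as soon as the disc contains two adjacent points. The spacing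
  \<open>t = 1\<close> is therefore optimal among lattices, with value \<open>- 4\<close>. For a square of
  \<open>n * n\<close> points with \<open>n = \<lfloor>sqrt N\<rfloor>\<close> the loss is \<open>O(sqrt N)\<close>, and so is the number of
  further lattice points needed to reach \<open>N\<close>; adding those can only create bonds.
\<close>

section \<open>The energy as a sum of degrees\<close>

definition separated :: "'a::metric_space set \<Rightarrow> bool" where
  "separated X \<longleftrightarrow> (\<forall>x\<in>X. \<forall>y\<in>X. x \<noteq> y \<longrightarrow> 1 \<le> dist x y)"

definition neighbours :: "'a::metric_space set \<Rightarrow> 'a \<Rightarrow> 'a set" where
  "neighbours X x = {y\<in>X. y \<noteq> x \<and> dist x y \<le> sqrt 2}"

lemma finite_neighbours [simp]: "finite X \<Longrightarrow> finite (neighbours X x)"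
  by (simp add: neighbours_def)

lemma energy_separated:
  assumes fin: "finite X" and sep: "separated X"
  shows "energy sticky_potential X = ereal (- (\<Sum>x\<in>X. real (card (neighbours X x))) / 2)"
proof -
  have "(\<Sum>y\<in>X - {x}. sticky_potential (norm (x - y))) = ereal (- real (card (neighbours X x)))"
    if x: "x \<in> X" for x
  proof -
    have "(\<Sum>y\<in>X - {x}. sticky_potential (norm (x - y)))
        = (\<Sum>y\<in>X - {x}. ereal (if y \<in> neighbours X x then -1 else 0))"
    proof (rule sum.cong[OF refl])
      fix y assume y: "y \<in> X - {x}"
      then have "1 \<le> norm (x - y)"
        using sep x unfolding separated_def dist_norm by (metis Diff_iff insertI1)
      then show "sticky_potential (norm (x - y)) = ereal (if y \<in> neighbours X x then -1 else 0)"
        using y by (auto simp: sticky_potential_def neighbours_def dist_norm one_ereal_def)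
    qed
    also have "\<dots> = ereal (\<Sum>y\<in>X - {x}. if y \<in> neighbours X x then -1 else 0)"
      by (rule sum_ereal)
    also have "(\<Sum>y\<in>X - {x}. if y \<in> neighbours X x then -1 else 0)
        = (\<Sum>y\<in>(X - {x}) \<inter> neighbours X x. - 1 :: real)"
      using fin by (subst sum.inter_restrict) auto
    also have "(X - {x}) \<inter> neighbours X x = neighbours X x"
      by (auto simp: neighbours_def)
    finally show ?thesis by simp
  qed
  then have "energy sticky_potential X
      = ereal (1/2) * (\<Sum>x\<in>X. ereal (- real (card (neighbours X x))))"
    unfolding energy_def by simp
  also have "\<dots> = ereal (1/2 * (\<Sum>x\<in>X. - real (card (neighbours X x))))"
    by (simp only: sum_ereal times_ereal.simps)
  finally show ?thesis by (simp add: sum_negf)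
qed

lemma energy_not_separated:
  assumes "finite X" and "\<not> separated X"
  shows "energy sticky_potential X = \<infinity>"
proof -
  obtain x y where xy: "x \<in> X" "y \<in> X - {x}" "norm (x - y) < 1"
    using assms(2) unfolding separated_def dist_norm by (metis Diff_iff not_le singletonD)
  then have "(\<Sum>y\<in>X - {x}. sticky_potential (norm (x - y))) = \<infinity>"
    using assms(1) by (subst sum_Pinfty) (auto simp: sticky_potential_def)
  then have "(\<Sum>x\<in>X. \<Sum>y\<in>X - {x}. sticky_potential (norm (x - y))) = \<infinity>"
    using assms(1) xy by (subst sum_Pinfty) auto
  then show ?thesis
    by (simp add: energy_def)
qed

section \<open>At most eight neighbours\<close>

text \<open>
  By the triple angle formula, \<open>cos (2 * pi / 9)\<close> is a root of \<open>4 x\<^sup>3 - 3 x + 1 / 2\<close>. This cubic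
  increases for \<open>x \<ge> 1 / 2\<close> and is \<open>- 1 / 16\<close> at \<open>3 / 4\<close>, so its root lies further to the right.
\<close>

lemma cos_gt_three_quarters:
  assumes "\<bar>\<theta>\<bar> \<le> 2 * pi / 9"
  shows "3 / 4 < cos \<theta>"
proof -
  define c where "c = cos (2 * pi / 9)"
  have "cos (3 * (2 * pi / 9)) = cos (pi - pi / 3)"
    by (simp add: field_simps)
  also have "\<dots> = - (1 / 2)"
    by (simp only: cos_pi_minus cos_60)
  finally have cubic: "4 * c ^ 3 - 3 * c = - (1 / 2)"
    unfolding c_def cos_treble_cos[symmetric] .
  have "cos (pi / 3) \<le> c"
    unfolding c_def by (rule cos_monotone_0_pi_le) (use pi_gt_zero in auto)
  then have half: "1 / 2 \<le> c"
    by (simp add: cos_60)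
  have "3 / 4 < c"
  proof (rule ccontr)
    assume "\<not> 3 / 4 < c"
    moreover have "0 \<le> 4 * c\<^sup>2 + 3 * c - 3 / 4"
      using half zero_le_power2[of c] by linarith
    ultimately have "0 \<le> (3 / 4 - c) * (4 * c\<^sup>2 + 3 * c - 3 / 4)"
      by (intro mult_nonneg_nonneg) auto
    then show False
      using cubic by (simp add: algebra_simps power2_eq_square power3_eq_cube)
  qed
  also have "c \<le> cos \<bar>\<theta>\<bar>"
    unfolding c_def by (rule cos_monotone_0_pi_le) (use assms pi_gt_zero in auto)
  finally show ?thesis
    by simp
qed

text \<open>
  For fixed \<open>s\<close> the left-hand side is convex in \<open>r\<close>, so for \<open>1 \<le> r \<le> s\<close> it is enough to look at
  \<open>r = 1\<close> and at \<open>r = s\<close>. The constant \<open>3 / 2\<close> is sharp: equality holds at \<open>r = s = sqrt 2\<close>.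
\<close>

lemma annulus_quadratic_le_one:
  fixes r s :: real
  assumes "1 \<le> r" "r \<le> sqrt 2" "1 \<le> s" "s \<le> sqrt 2"
  shows "r\<^sup>2 + s\<^sup>2 - 3 / 2 * r * s \<le> 1"
  using assms
proof (induction r s rule: linorder_wlog)
  case (le r s)
  have s2: "s\<^sup>2 \<le> 2"
    using le by (metis abs_of_nonneg order_trans real_sqrt_abs real_sqrt_le_iff zero_le_one)
  then have "s < 2"
    by (rule_tac power2_less_imp_less) auto
  have "(r - 1) * (s - r) \<ge> 0"
    using le by simp
  moreover have "(s - r) * (1 - s / 2) \<ge> 0"
    using le \<open>s < 2\<close> by simp
  ultimately show ?case
    using s2 by (simp add: field_simps power2_eq_square)
next
  case (sym r s)
  then show ?case by (simp add: algebra_simps)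
qed

lemma norm_rcis_diff_square:
  "(norm (rcis r a - rcis s b))\<^sup>2 = r\<^sup>2 + s\<^sup>2 - 2 * r * s * cos (a - b)"
proof -
  have "(norm (rcis r a - rcis s b))\<^sup>2
      = r\<^sup>2 * ((cos a)\<^sup>2 + (sin a)\<^sup>2) + s\<^sup>2 * ((cos b)\<^sup>2 + (sin b)\<^sup>2) - 2 * r * s * cos (a - b)"
    unfolding cmod_power2 cos_diff minus_complex.sel Re_rcis Im_rcis
    by algebra
  then show ?thesis by simp
qed

lemma rcis_close:
  assumes "1 \<le> r" "r \<le> sqrt 2" "1 \<le> s" "s \<le> sqrt 2" and "\<bar>a - b\<bar> \<le> 2 * pi / 9"
  shows "norm (rcis r a - rcis s b) < 1"
proof -
  have "(norm (rcis r a - rcis s b))\<^sup>2 = r\<^sup>2 + s\<^sup>2 - 2 * r * s * cos (a - b)"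
    by (rule norm_rcis_diff_square)
  also have "\<dots> < r\<^sup>2 + s\<^sup>2 - 2 * r * s * (3 / 4)"
  proof -
    have "2 * r * s * (3 / 4) < 2 * r * s * cos (a - b)"
      using cos_gt_three_quarters[OF assms(5)] assms by (intro mult_strict_left_mono) auto
    then show ?thesis by linarith
  qed
  also have "\<dots> \<le> 1\<^sup>2"
    using annulus_quadratic_le_one[OF assms(1-4)] by simp
  finally show ?thesis
    by (rule power2_less_imp_less) simp
qed

text \<open>
  One of the points is rotated to the positive real axis. All others then have their arguments
  strictly between 40 and 320 degrees, a range that splits into seven sectors of 40 degrees, each
  containing at most one point.
\<close>

lemma card_annulus_le_8_complex:
  fixes S :: "complex set"
  assumes fin: "finite S"
    and ann: "\<And>z. z \<in> S \<Longrightarrow> 1 \<le> norm z \<and> norm z \<le> sqrt 2"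
    and sep: "separated S"
  shows "card S \<le> 8"
proof (cases "S = {}")
  case False
  then obtain w where w: "w \<in> S" by blast
  have "w \<noteq> 0"
    using ann[OF w] by auto
  define u where "u = w / of_real (norm w)"
  have u: "norm u = 1" "u \<noteq> 0"
    using \<open>w \<noteq> 0\<close> by (auto simp: u_def norm_divide)
  define \<alpha> where "\<alpha> z = Arg2pi (z / u)" for z
  have polar: "z = u * rcis (norm z) (\<alpha> z)" for z
  proof -
    have "z / u = rcis (norm (z / u)) (\<alpha> z)"
      using Arg2pi_eq[of "z / u"] unfolding \<alpha>_def rcis_def cis_conv_exp by (simp add: mult.commute)
    then show ?thesis
      using u by (simp add: norm_divide field_simps)
  qed
  have \<alpha>_range: "0 \<le> \<alpha> z" "\<alpha> z < 2 * pi" for z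
    by (auto simp: \<alpha>_def Arg2pi_ge_0 Arg2pi_lt_2pi)
  \<comment> \<open>The angle \<open>a\<close> of the first point is left free up to multiples of \<open>2 * pi\<close>: points just below the
      positive real axis are compared with \<open>w\<close> through the angle \<open>\<alpha> z - 2 * pi\<close>.\<close>
  have apart: "\<not> \<bar>a - b\<bar> \<le> 2 * pi / 9"
    if "z \<in> S" "z' \<in> S" "z \<noteq> z'" "rcis (norm z) a = rcis (norm z) (\<alpha> z)" "b = \<alpha> z'" for z z' a b
  proof
    assume "\<bar>a - b\<bar> \<le> 2 * pi / 9"
    then have "norm (rcis (norm z) a - rcis (norm z') b) < 1"
      using ann that(1,2) by (intro rcis_close) auto
    moreover have "norm (z - z') = norm (rcis (norm z) a - rcis (norm z') b)"
      using arg_cong2[OF polar[of z] polar[of z'], of "\<lambda>a b. norm (a - b)"] that(4,5) u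
      by (simp only: right_diff_distrib[symmetric] norm_mult mult_1)
    ultimately show False
      using sep that(1-3) by (force simp: separated_def dist_norm)
  qed
  have \<alpha>w: "\<alpha> w = 0"
    using \<open>w \<noteq> 0\<close> by (simp add: \<alpha>_def u_def Arg2pi_of_real)
  define k where "k z = \<lfloor>9 * \<alpha> z / (2 * pi)\<rfloor>" for z
  have "inj_on k (S - {w})"
  proof (rule inj_onI, rule ccontr)
    fix z z' assume *: "z \<in> S - {w}" "z' \<in> S - {w}" "k z = k z'" "z \<noteq> z'"
    have "\<bar>9 * \<alpha> z / (2 * pi) - 9 * \<alpha> z' / (2 * pi)\<bar> < 1"
      using *(3) unfolding k_def by linarith
    then have "2 * pi / 9 * \<bar>9 * \<alpha> z / (2 * pi) - 9 * \<alpha> z' / (2 * pi)\<bar> \<le> 2 * pi / 9 * 1"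
      by (intro mult_left_mono) auto
    moreover have "\<alpha> z - \<alpha> z' = 2 * pi / 9 * (9 * \<alpha> z / (2 * pi) - 9 * \<alpha> z' / (2 * pi))"
      by (simp add: field_simps)
    moreover have "\<bar>2 * pi / 9 * x\<bar> = 2 * pi / 9 * \<bar>x\<bar>" for x
      by (simp add: abs_mult)
    ultimately have "\<bar>\<alpha> z - \<alpha> z'\<bar> \<le> 2 * pi / 9"
      by (metis mult.right_neutral)
    with apart[of z z'] * show False by auto
  qed
  moreover have "k ` (S - {w}) \<subseteq> {1..7}"
  proof (rule image_subsetI)
    fix z assume "z \<in> S - {w}"
    then have z: "z \<in> S" "z \<noteq> w" by auto
    have "\<not> \<alpha> z \<le> 2 * pi / 9"
      using apart[of z w "\<alpha> z" "\<alpha> w"] z w \<alpha>w \<alpha>_range[of z] by auto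
    then have "1 \<le> 9 * \<alpha> z / (2 * pi)"
      by (simp add: field_simps)
    moreover have "\<not> 2 * pi - \<alpha> z \<le> 2 * pi / 9"
      using apart[of z w "\<alpha> z - 2 * pi" "\<alpha> w"] z w \<alpha>w \<alpha>_range[of z]
      by (auto simp: complex_eq_iff cos_diff sin_diff)
    then have "9 * \<alpha> z / (2 * pi) < 8"
      by (simp add: field_simps)
    ultimately show "k z \<in> {1..7}"
      by (simp add: k_def)
  qed
  ultimately have "card (S - {w}) \<le> card {1..7::int}"
    by (rule card_inj_on_le) simp
  then show ?thesis
    using w fin by (simp add: card_Diff_singleton)
qed simp

lemma card_neighbours_le_8:
  fixes X :: "(real^2) set"
  assumes fin: "finite X" and sep: "separated X" and x: "x \<in> X"
  shows "card (neighbours X x) \<le> 8"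
proof -
  define f where "f y = Complex ((y - x) $ 1) ((y - x) $ 2)" for y :: "real^2"
  have dist_f: "dist (f y) (f z) = dist y z" for y z
    by (simp add: f_def dist_norm norm_complex_def norm_vec_def L2_set_def UNIV_2)
  have norm_f: "norm (f y) = dist x y" for y
    using dist_f[of y x] by (simp add: f_def dist_norm norm_minus_commute zero_complex.ctr[symmetric])
  have inj: "inj_on f (neighbours X x)"
    by (rule inj_onI) (metis dist_f dist_eq_0_iff)
  have "card (f ` neighbours X x) \<le> 8"
  proof (rule card_annulus_le_8_complex)
    show "finite (f ` neighbours X x)"
      using fin by simp
    show "separated (f ` neighbours X x)"
      using sep unfolding separated_def neighbours_def by (auto simp: dist_f)
    fix z assume "z \<in> f ` neighbours X x"
    then obtain y where y: "y \<in> neighbours X x" "z = f y" by blast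
    then show "1 \<le> norm z \<and> norm z \<le> sqrt 2"
      using sep x unfolding separated_def neighbours_def by (auto simp: norm_f)
  qed
  then show ?thesis
    using inj by (simp add: card_image)
qed

lemma energy_ge:
  assumes fin: "finite X"
  shows "ereal (- 4 * real (card X)) \<le> energy sticky_potential X"
proof (cases "separated X")
  case True
  have "(\<Sum>x\<in>X. real (card (neighbours X x))) \<le> (\<Sum>x\<in>X. 8)"
    using card_neighbours_le_8[OF fin True] by (intro sum_mono) simp
  then show ?thesis
    using energy_separated[OF fin True] by simp
qed (simp add: energy_not_separated[OF fin])

lemma ground_energy_ge: "ereal (- 4 * real N) \<le> ground_energy sticky_potential N"
  unfolding ground_energy_def by (rule INF_greatest) (use energy_ge in auto)

lemma infinite_plane: "infinite (UNIV :: (real^2) set)"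
  by (simp add: infinite_UNIV_char_0)

text \<open>
  All energies of \<open>N\<close> points are infinite or half-integers between \<open>- 4 N\<close> and 0, so the infimum is
  taken over a finite set.
\<close>

lemma ground_energy_attained:
  "\<exists>X. finite X \<and> card X = N \<and> energy sticky_potential X = ground_energy sticky_potential N"
proof -
  define E where "E = energy sticky_potential ` {X. finite X \<and> card X = N}"
  have "E \<subseteq> insert \<infinity> ((\<lambda>m::nat. ereal (- real m / 2)) ` {..8 * N})"
  proof
    fix e assume "e \<in> E"
    then obtain X where X: "finite X" "card X = N" "e = energy sticky_potential X"
      by (auto simp: E_def)
    show "e \<in> insert \<infinity> ((\<lambda>m::nat. ereal (- real m / 2)) ` {..8 * N})"
    proof (cases "separated X")
      case True
      define m where "m = (\<Sum>x\<in>X. card (neighbours X x))"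
      have "m \<le> (\<Sum>x\<in>X. 8)"
        unfolding m_def using card_neighbours_le_8[OF X(1) True] by (intro sum_mono)
      moreover have "e = ereal (- real m / 2)"
        using energy_separated[OF X(1) True] X(3) by (simp add: m_def)
      ultimately show ?thesis
        using X(2) by auto
    qed (use X energy_not_separated in auto)
  qed
  then have "finite E"
    by (rule finite_subset) simp
  moreover have "E \<noteq> {}"
    using infinite_arbitrarily_large[OF infinite_plane, of N] by (auto simp: E_def)
  ultimately have "Inf E \<in> E"
    by (metis Min_Inf Min_in)
  then show ?thesis
    unfolding E_def ground_energy_def by auto
qed

section \<open>Bonds in lattice configurations\<close>

definition lattice_point :: "real \<Rightarrow> int \<times> int \<Rightarrow> real^2" where
  "lattice_point t p = t *\<^sub>R vector [of_int (fst p), of_int (snd p)]"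

lemma square_lattice_eq: "square_lattice t = range (lattice_point t)"
proof -
  have "{x :: real^2. \<forall>i. x $ i \<in> \<int>} = range (\<lambda>p. vector [of_int (fst p), of_int (snd p)])"
  proof (intro equalityI subsetI)
    fix x :: "real^2" assume "x \<in> {x. \<forall>i. x $ i \<in> \<int>}"
    then obtain m n where "x $ 1 = of_int m" "x $ 2 = of_int n"
      by (metis Ints_cases mem_Collect_eq)
    then have "x = vector [of_int (fst (m, n)), of_int (snd (m, n))]"
      by (simp add: vec_eq_iff forall_2)
    then show "x \<in> range (\<lambda>p. vector [of_int (fst p), of_int (snd p)])"
      by blast
  qed (auto simp: forall_2)
  then show ?thesis
    unfolding square_lattice_def lattice_point_def by auto
qed

lemma lattice_point_diff: "lattice_point t p - lattice_point t q = lattice_point t (p - q)"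
  by (simp add: lattice_point_def vec_eq_iff forall_2 algebra_simps)

lemma norm_lattice_point:
  assumes "0 \<le> t"
  shows "norm (lattice_point t p) = t * sqrt (of_int ((fst p)\<^sup>2 + (snd p)\<^sup>2))"
  using assms unfolding lattice_point_def norm_scaleR
  by (simp add: norm_vec_def L2_set_def UNIV_2)

lemma inj_lattice_point:
  assumes "0 < t"
  shows "inj (lattice_point t)"
  using assms by (intro injI) (auto simp: lattice_point_def vec_eq_iff forall_2 prod_eq_iff)

definition bond_directions :: "real \<Rightarrow> (int \<times> int) set" where
  "bond_directions t = {d. d \<noteq> 0 \<and> norm (lattice_point t d) \<le> sqrt 2}"

lemma lattice_square_ge_one: "(p :: int \<times> int) \<noteq> 0 \<Longrightarrow> 1 \<le> (fst p)\<^sup>2 + (snd p)\<^sup>2"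
  using sum_power2_gt_zero_iff[of "fst p" "snd p"] by (auto simp: prod_eq_iff)

lemma separated_lattice_points:
  assumes "1 \<le> t"
  shows "separated (lattice_point t ` A)"
proof -
  have "1 \<le> norm (lattice_point t p)" if "p \<noteq> 0" for p
  proof -
    have "real_of_int 1 \<le> of_int ((fst p)\<^sup>2 + (snd p)\<^sup>2)"
      using lattice_square_ge_one[OF that] by (simp only: of_int_le_iff)
    then have "1 \<le> sqrt (of_int ((fst p)\<^sup>2 + (snd p)\<^sup>2))"
      by simp
    with assms show ?thesis
      unfolding norm_lattice_point[OF order_trans[OF zero_le_one assms]]
      by (metis mult_mono mult_1 zero_le_one order_trans)
  qed
  then have "1 \<le> dist (lattice_point t p) (lattice_point t q)" if "p \<noteq> q" for p q
    using that by (simp add: dist_norm lattice_point_diff)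
  then show ?thesis
    unfolding separated_def by (metis imageE)
qed

lemma bond_directions_subset:
  assumes "1 \<le> t"
  shows "bond_directions t \<subseteq> bond_directions 1"
  unfolding bond_directions_def
proof clarify
  fix d assume "norm (lattice_point t d) \<le> sqrt 2"
  moreover have "norm (lattice_point 1 d) \<le> norm (lattice_point t d)"
    using assms unfolding lattice_point_def norm_scaleR by (intro mult_right_mono) auto
  ultimately show "norm (lattice_point 1 d) \<le> sqrt 2" by linarith
qed

lemma bond_directions_1: "bond_directions 1 = {-1..1} \<times> {-1..1} - {0}"
proof -
  have "norm (lattice_point 1 d) \<le> sqrt 2 \<longleftrightarrow> fst d \<in> {-1..1} \<and> snd d \<in> {-1..1}" for d
  proof -
    have "norm (lattice_point 1 d) \<le> sqrt 2 \<longleftrightarrow> (fst d)\<^sup>2 + (snd d)\<^sup>2 \<le> 2"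
      unfolding norm_lattice_point[OF zero_le_one] mult_1 real_sqrt_le_iff by linarith
    also have "\<dots> \<longleftrightarrow> \<bar>fst d\<bar> \<le> 1 \<and> \<bar>snd d\<bar> \<le> 1"
    proof
      assume le: "(fst d)\<^sup>2 + (snd d)\<^sup>2 \<le> 2"
      have "\<bar>a\<bar> < 2" if "a\<^sup>2 \<le> 2" for a :: int
        by (rule power2_less_imp_less) (use that in auto)
      moreover have "(fst d)\<^sup>2 \<le> 2" "(snd d)\<^sup>2 \<le> 2"
        using le zero_le_power2[of "fst d"] zero_le_power2[of "snd d"] by linarith+
      ultimately have "\<bar>fst d\<bar> < 2" "\<bar>snd d\<bar> < 2"
        by blast+
      then show "\<bar>fst d\<bar> \<le> 1 \<and> \<bar>snd d\<bar> \<le> 1"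
        by linarith
    next
      assume "\<bar>fst d\<bar> \<le> 1 \<and> \<bar>snd d\<bar> \<le> 1"
      then have "(fst d)\<^sup>2 \<le> 1" "(snd d)\<^sup>2 \<le> 1"
        by (simp_all add: abs_square_le_1)
      then show "(fst d)\<^sup>2 + (snd d)\<^sup>2 \<le> 2" by linarith
    qed
    finally show ?thesis by auto
  qed
  then show ?thesis
    by (auto simp: bond_directions_def)
qed

lemma finite_bond_directions:
  assumes "1 \<le> t"
  shows "finite (bond_directions t)"
  by (rule finite_subset[OF bond_directions_subset[OF assms]]) (simp add: bond_directions_1)

lemma card_bond_directions_1: "card (bond_directions 1) = 8"
  by (simp add: bond_directions_1 card_Diff_singleton zero_prod_def card_cartesian_product)

lemma card_bond_directions_le:
  assumes "1 \<le> t"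
  shows "card (bond_directions t) \<le> 8"
  using card_mono[OF finite_bond_directions[OF order_refl] bond_directions_subset[OF assms]]
  by (simp add: card_bond_directions_1)

lemma card_neighbours_lattice:
  assumes "0 < t"
  shows "card (neighbours (lattice_point t ` A) (lattice_point t p))
       = card {d \<in> bond_directions t. p + d \<in> A}"
proof -
  have inj: "inj (lattice_point t)"
    by (rule inj_lattice_point[OF assms])
  have "neighbours (lattice_point t ` A) (lattice_point t p)
      = (\<lambda>d. lattice_point t (p + d)) ` {d \<in> bond_directions t. p + d \<in> A}"
  proof (intro equalityI subsetI)
    fix y assume "y \<in> neighbours (lattice_point t ` A) (lattice_point t p)"
    then obtain q where q: "q \<in> A" "y = lattice_point t q" "y \<noteq> lattice_point t p"
        "dist y (lattice_point t p) \<le> sqrt 2"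
      unfolding neighbours_def by (auto simp: dist_commute)
    then have "q \<noteq> p" "norm (lattice_point t (q - p)) \<le> sqrt 2"
      by (auto simp: dist_norm lattice_point_diff)
    with q(1,2) show "y \<in> (\<lambda>d. lattice_point t (p + d)) ` {d \<in> bond_directions t. p + d \<in> A}"
      by (intro image_eqI[of _ _ "q - p"]) (auto simp: bond_directions_def)
  next
    fix y assume "y \<in> (\<lambda>d. lattice_point t (p + d)) ` {d \<in> bond_directions t. p + d \<in> A}"
    then show "y \<in> neighbours (lattice_point t ` A) (lattice_point t p)"
      using inj by (auto simp: neighbours_def bond_directions_def inj_eq dist_norm
          norm_minus_commute[of "lattice_point t p"] lattice_point_diff)
  qed
  moreover have "inj_on (\<lambda>d. lattice_point t (p + d)) {d \<in> bond_directions t. p + d \<in> A}"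
    using inj by (auto intro!: inj_onI simp: inj_eq)
  ultimately show ?thesis
    by (simp add: card_image)
qed

lemma energy_lattice:
  assumes "1 \<le> t" and "finite A"
  shows "energy sticky_potential (lattice_point t ` A)
       = ereal (- (\<Sum>p\<in>A. real (card {d \<in> bond_directions t. p + d \<in> A})) / 2)"
proof -
  have "0 < t" using assms by simp
  then have inj: "inj_on (lattice_point t) A"
    using inj_lattice_point inj_on_subset by blast
  show ?thesis
    using energy_separated[OF finite_imageI[OF assms(2)] separated_lattice_points[OF assms(1)]]
    by (simp add: sum.reindex[OF inj] card_neighbours_lattice[OF \<open>0 < t\<close>])
qed

text \<open>
  The lattice trace of convexity: a point and a later point on the same lattice line force the next
  point on that line to belong to the set. Together with the box containing the set, this is all
  that the count of lost bonds uses.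
\<close>

definition line_convex :: "(int \<times> int) set \<Rightarrow> bool" where
  "line_convex A \<longleftrightarrow> (\<forall>p d k. p \<in> A \<longrightarrow> 1 \<le> k \<longrightarrow> p + (k * fst d, k * snd d) \<in> A \<longrightarrow> p + d \<in> A)"

text \<open>
  The points with no successor in direction \<open>d\<close> lie on different lattice lines with direction \<open>d\<close>,
  since a line leaves a line-convex set only once. These lines are the level sets of
  \<open>h p = fst d * snd p - snd d * fst p\<close>, because the coordinates of \<open>d\<close> are 0, 1 or -1 and
  so \<open>d\<close> is primitive; on the box \<open>\<bar>h\<bar> \<le> 2 M\<close>.
\<close>

lemma card_exits_le:
  assumes A: "A \<subseteq> {-M..M} \<times> {-M..M}" and conv: "line_convex A" and M: "0 \<le> M"
    and d: "d \<in> bond_directions 1"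
  shows "card {p \<in> A. p + d \<notin> A} \<le> nat (4 * M + 1)"
proof -
  define h where "h p = fst d * snd p - snd d * fst p" for p :: "int \<times> int"
  have d': "fst d \<in> {-1,0,1}" "snd d \<in> {-1,0,1}" "fst d \<noteq> 0 \<or> snd d \<noteq> 0"
    using d by (auto simp: bond_directions_1 prod_eq_iff)
  have parallel: "\<exists>k. q = p + (k * fst d, k * snd d)" if "h p = h q" for p q
    using d' that
    by (intro exI[of _ "if fst d \<noteq> 0 then (fst q - fst p) * fst d else (snd q - snd p) * snd d"])
       (auto simp: h_def prod_eq_iff)
  have "inj_on h {p \<in> A. p + d \<notin> A}"
  proof (rule inj_onI)
    fix p q assume p: "p \<in> {p \<in> A. p + d \<notin> A}" and q: "q \<in> {p \<in> A. p + d \<notin> A}" and "h p = h q"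
    then obtain k where k: "q = p + (k * fst d, k * snd d)"
      using parallel by blast
    then have k': "p = q + (- k * fst d, - k * snd d)"
      by (simp add: prod_eq_iff)
    have "\<not> 1 \<le> k"
      using conv p q k unfolding line_convex_def by blast
    moreover have "\<not> 1 \<le> - k"
      using conv p q k' unfolding line_convex_def by blast
    ultimately have "k = 0" by linarith
    then show "p = q"
      using k by (simp add: prod_eq_iff)
  qed
  moreover have "h ` {p \<in> A. p + d \<notin> A} \<subseteq> {-(2*M)..2*M}"
    using A d' by (force simp: h_def)
  ultimately have "card {p \<in> A. p + d \<notin> A} \<le> card {-(2*M)..2*M}"
    by (rule card_inj_on_le) simp
  then show ?thesis
    by simp
qed

text \<open>
  Counting the pairs of a point and a bond direction by directions first turns the bound on exits
  into a bound on the sum of the degrees.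
\<close>

lemma bond_count_ge:
  assumes t: "1 \<le> t" and A: "A \<subseteq> {-M..M} \<times> {-M..M}" and conv: "line_convex A" and M: "0 \<le> M"
  shows "real (card (bond_directions t)) * (real (card A) - (4 * of_int M + 1))
       \<le> (\<Sum>p\<in>A. real (card {d \<in> bond_directions t. p + d \<in> A}))"
proof -
  have fin: "finite A"
    using A by (rule finite_subset) simp
  note finD = finite_bond_directions[OF t]
  have "real (card A) - (4 * of_int M + 1) \<le> real (card {p \<in> A. p + d \<in> A})"
    if d: "d \<in> bond_directions t" for d
  proof -
    have "card A = card {p \<in> A. p + d \<in> A} + card {p \<in> A. p + d \<notin> A}"
      using fin by (subst card_Un_disjoint[symmetric]) (auto intro: arg_cong[where f = card])
    moreover have "card {p \<in> A. p + d \<notin> A} \<le> nat (4 * M + 1)"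
      using card_exits_le[OF A conv M] d bond_directions_subset[OF t] by blast
    ultimately show ?thesis
      using M by linarith
  qed
  then have "(\<Sum>d\<in>bond_directions t. real (card A) - (4 * of_int M + 1))
      \<le> (\<Sum>d\<in>bond_directions t. real (card {p \<in> A. p + d \<in> A}))"
    by (rule sum_mono)
  also have "\<dots> = real (\<Sum>d\<in>bond_directions t. card {p \<in> A. p + d \<in> A})"
    by simp
  also have "(\<Sum>d\<in>bond_directions t. card {p \<in> A. p + d \<in> A})
      = (\<Sum>p\<in>A. card {d \<in> bond_directions t. p + d \<in> A})"
    by (rule sum_multicount_gen[symmetric]) (use fin finD in auto)
  finally show ?thesis
    by simp
qed

section \<open>The mean energy of square lattices\<close>

definition lattice_disc :: "real \<Rightarrow> real \<Rightarrow> (int \<times> int) set" where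
  "lattice_disc t R = {p. norm (lattice_point t p) < R}"

lemma square_lattice_ball: "square_lattice t \<inter> ball 0 R = lattice_point t ` lattice_disc t R"
  by (auto simp: square_lattice_eq lattice_disc_def)

lemma lattice_disc_subset:
  assumes "0 < t"
  shows "lattice_disc t R \<subseteq> {-\<lfloor>R / t\<rfloor>..\<lfloor>R / t\<rfloor>} \<times> {-\<lfloor>R / t\<rfloor>..\<lfloor>R / t\<rfloor>}"
proof
  fix p assume "p \<in> lattice_disc t R"
  then have R: "norm (lattice_point t p) < R"
    by (simp add: lattice_disc_def)
  have "t * \<bar>of_int a\<bar> \<le> norm (lattice_point t p)" if "a\<^sup>2 \<le> (fst p)\<^sup>2 + (snd p)\<^sup>2" for a
  proof -
    have "real_of_int (a\<^sup>2) \<le> of_int ((fst p)\<^sup>2 + (snd p)\<^sup>2)"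
      using that by (simp only: of_int_le_iff)
    then have "sqrt (of_int (a\<^sup>2)) \<le> sqrt (of_int ((fst p)\<^sup>2 + (snd p)\<^sup>2))"
      by (rule real_sqrt_le_mono)
    then show ?thesis
      using assms by (simp add: norm_lattice_point)
  qed
  from this[of "fst p"] this[of "snd p"]
  have "t * \<bar>of_int (fst p)\<bar> \<le> R" "t * \<bar>of_int (snd p)\<bar> \<le> R"
    using R by auto
  then have "of_int \<bar>fst p\<bar> \<le> R / t" "of_int \<bar>snd p\<bar> \<le> R / t"
    using assms by (simp_all add: field_simps)
  then have "\<bar>fst p\<bar> \<le> \<lfloor>R / t\<rfloor>" "\<bar>snd p\<bar> \<le> \<lfloor>R / t\<rfloor>"
    by (simp_all only: le_floor_iff)
  then show "p \<in> {-\<lfloor>R / t\<rfloor>..\<lfloor>R / t\<rfloor>} \<times> {-\<lfloor>R / t\<rfloor>..\<lfloor>R / t\<rfloor>}"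
    by (auto simp: mem_Times_iff abs_le_iff)
qed

lemma finite_lattice_disc: "0 < t \<Longrightarrow> finite (lattice_disc t R)"
  by (rule finite_subset[OF lattice_disc_subset]) auto

lemma line_convex_preimage:
  assumes "convex K"
  shows "line_convex {p. lattice_point t p \<in> K}"
  unfolding line_convex_def
proof (intro allI impI, unfold mem_Collect_eq)
  fix p d :: "int \<times> int" and k :: int
  assume p: "lattice_point t p \<in> K" and k: "1 \<le> k"
    and q: "lattice_point t (p + (k * fst d, k * snd d)) \<in> K"
  have "(1 - 1 / of_int k) *\<^sub>R lattice_point t p
      + (1 / of_int k) *\<^sub>R lattice_point t (p + (k * fst d, k * snd d)) \<in> K"
    using assms p q k by (intro convexD) auto
  also have "(1 - 1 / of_int k) *\<^sub>R lattice_point t p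
      + (1 / of_int k) *\<^sub>R lattice_point t (p + (k * fst d, k * snd d)) = lattice_point t (p + d)"
    using k by (simp add: lattice_point_def vec_eq_iff forall_2 field_simps)
  finally show "lattice_point t (p + d) \<in> K" .
qed

lemma line_convex_lattice_disc: "line_convex (lattice_disc t R)"
  using line_convex_preimage[OF convex_ball[of 0 R], of t] by (simp add: lattice_disc_def)

text \<open>
  The disc contains the lattice points of the square with opposite corners \<open>(0, 0)\<close> and
  \<open>(R / 2, R / 2)\<close>. A lower bound of order \<open>R\<^sup>2\<close> is enough, since it only has to dominate the loss of bonds at the boundary.
\<close>

lemma card_lattice_disc_ge:
  assumes t: "0 < t" and R: "0 < R"
  shows "(R / (2 * t))\<^sup>2 \<le> real (card (lattice_disc t R))"
proof -
  define j where "j = \<lfloor>R / (2 * t)\<rfloor>"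
  have j0: "0 \<le> j"
    using t R by (simp add: j_def)
  have "{0..j} \<times> {0..j} \<subseteq> lattice_disc t R"
  proof clarify
    fix a b assume ab: "a \<in> {0..j}" "b \<in> {0..j}"
    then have "a\<^sup>2 \<le> j\<^sup>2" "b\<^sup>2 \<le> j\<^sup>2"
      by (auto intro!: power_mono)
    then have "real_of_int (a\<^sup>2 + b\<^sup>2) \<le> of_int (2 * j\<^sup>2)"
      by (simp only: of_int_le_iff)
    also have "\<dots> \<le> 2 * (R / (2 * t))\<^sup>2"
      using j0 by (simp add: j_def power_mono)
    also have "\<dots> = (R / t)\<^sup>2 / 2"
      by (simp add: power_divide power_mult_distrib)
    also have "\<dots> < (R / t)\<^sup>2"
      using R t by simp
    finally have "sqrt (of_int (a\<^sup>2 + b\<^sup>2)) < R / t"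
      using R t by (intro real_less_lsqrt) auto
    then show "(a, b) \<in> lattice_disc t R"
      using t by (simp add: lattice_disc_def norm_lattice_point field_simps)
  qed
  then have "card ({0..j} \<times> {0..j}) \<le> card (lattice_disc t R)"
    by (rule card_mono[OF finite_lattice_disc[OF t]])
  then have "real (nat (j + 1)) * real (nat (j + 1)) \<le> real (card (lattice_disc t R))"
    by (simp add: card_cartesian_product flip: of_nat_mult)
  moreover have "(R / (2 * t))\<^sup>2 \<le> real (nat (j + 1)) * real (nat (j + 1))"
  proof -
    have "R / (2 * t) \<le> real (nat (j + 1))"
      using j0 by (simp add: j_def)
    then show ?thesis
      using t R unfolding power2_eq_square by (intro mult_mono) auto
  qed
  ultimately show ?thesis by linarith
qed

lemma lattice_mean_energy_eq_bond_count:
  assumes t: "1 \<le> t" and R: "0 < R"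
  defines "b \<equiv> (\<Sum>p\<in>lattice_disc t R. real (card {d \<in> bond_directions t. p + d \<in> lattice_disc t R}))"
  shows "lattice_mean_energy sticky_potential t R = ereal (- b / 2 / real (card (lattice_disc t R)))"
proof -
  have t0: "0 < t" using t by simp
  have "card (lattice_point t ` lattice_disc t R) = card (lattice_disc t R)"
    by (rule card_image) (use inj_lattice_point[OF t0] inj_on_subset in blast)
  moreover have "0 < (R / (2 * t))\<^sup>2"
    using t0 R by simp
  then have "real (card (lattice_disc t R)) \<noteq> 0"
    using card_lattice_disc_ge[OF t0 R] by linarith
  ultimately show ?thesis
    unfolding lattice_mean_energy_def square_lattice_ball b_def
    using energy_lattice[OF t finite_lattice_disc[OF t0], of R]
    by simp
qed

text \<open>
  The mean energy exceeds its limit by half the number of lost bonds per point, which is of order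
  \<open>R / R\<^sup>2\<close>.
\<close>

lemma lattice_mean_energy_tendsto:
  assumes t: "1 \<le> t"
  shows "(lattice_mean_energy sticky_potential t \<longlongrightarrow> ereal (- real (card (bond_directions t)) / 2)) at_top"
proof -
  define D where "D = real (card (bond_directions t))"
  have t0: "0 < t" using t by simp
  define b where
    "b R = (\<Sum>p\<in>lattice_disc t R. real (card {d \<in> bond_directions t. p + d \<in> lattice_disc t R}))" for R
  define n where "n R = real (card (lattice_disc t R))" for R
  have lower: "- D / 2 \<le> - b R / 2 / n R" and
    upper: "- b R / 2 / n R \<le> - D / 2 + D / 2 * ((4 * (R / t) + 1) / (R / (2 * t))\<^sup>2)"
    if R: "0 < R" for R
  proof -
    have pos: "0 < (R / (2 * t))\<^sup>2"
      using R t0 by simp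
    have n: "(R / (2 * t))\<^sup>2 \<le> n R"
      using card_lattice_disc_ge[OF t0 R] by (simp add: n_def)
    have n0: "0 < n R" using n pos by linarith
    have "b R \<le> (\<Sum>p\<in>lattice_disc t R. D)"
      unfolding b_def D_def
      by (intro sum_mono) (auto intro!: card_mono finite_bond_directions[OF t])
    then have "b R \<le> n R * D"
      by (simp add: n_def)
    then show "- D / 2 \<le> - b R / 2 / n R"
      using n0 by (simp add: field_simps)
    have M0: "0 \<le> \<lfloor>R / t\<rfloor>"
      using R t0 by simp
    have "D * (n R - (4 * (R / t) + 1)) \<le> D * (n R - (4 * of_int \<lfloor>R / t\<rfloor> + 1))"
      using of_int_floor_le[of "R / t"] by (intro mult_left_mono) (linarith, simp add: D_def)
    also have "\<dots> \<le> b R"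
      unfolding D_def n_def b_def
      by (rule bond_count_ge[OF t lattice_disc_subset[OF t0] line_convex_lattice_disc M0])
    finally have "D * (n R - (4 * (R / t) + 1)) / n R \<le> b R / n R"
      using n0 by (simp add: divide_right_mono)
    moreover have "D * (n R - (4 * (R / t) + 1)) / n R = D - D * ((4 * (R / t) + 1) / n R)"
      using n0 by (simp add: diff_divide_distrib right_diff_distrib)
    ultimately have "- (b R / n R) / 2 \<le> - (D - D * ((4 * (R / t) + 1) / n R)) / 2"
      by (intro divide_right_mono) auto
    then have "- b R / 2 / n R \<le> - D / 2 + D / 2 * ((4 * (R / t) + 1) / n R)"
      by (simp add: diff_divide_distrib mult.commute)
    also have "D / 2 * ((4 * (R / t) + 1) / n R) \<le> D / 2 * ((4 * (R / t) + 1) / (R / (2 * t))\<^sup>2)"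
      using n pos n0 R t0 by (intro mult_left_mono divide_left_mono) (auto simp: D_def)
    finally show "- b R / 2 / n R \<le> - D / 2 + D / 2 * ((4 * (R / t) + 1) / (R / (2 * t))\<^sup>2)"
      by simp
  qed
  have "((\<lambda>R. (4 * (R / t) + 1) / (R / (2 * t))\<^sup>2) \<longlongrightarrow> 0) at_top"
    using t0 by real_asymp
  then have "((\<lambda>R. - D / 2 + D / 2 * ((4 * (R / t) + 1) / (R / (2 * t))\<^sup>2)) \<longlongrightarrow> - D / 2 + D / 2 * 0) at_top"
    by (intro tendsto_intros)
  then have lim: "((\<lambda>R. - D / 2 + D / 2 * ((4 * (R / t) + 1) / (R / (2 * t))\<^sup>2)) \<longlongrightarrow> - D / 2) at_top"
    by simp
  have "((\<lambda>R. - b R / 2 / n R) \<longlongrightarrow> - D / 2) at_top"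
  proof (rule tendsto_sandwich[OF _ _ tendsto_const lim])
    show "\<forall>\<^sub>F R in at_top. - D / 2 \<le> - b R / 2 / n R"
      using eventually_gt_at_top[of 0] by eventually_elim (rule lower)
    show "\<forall>\<^sub>F R in at_top. - b R / 2 / n R \<le> - D / 2 + D / 2 * ((4 * (R / t) + 1) / (R / (2 * t))\<^sup>2)"
      using eventually_gt_at_top[of 0] by eventually_elim (rule upper)
  qed
  then have "((\<lambda>R. ereal (- b R / 2 / n R)) \<longlongrightarrow> ereal (- D / 2)) at_top"
    by (rule tendsto_ereal)
  moreover have "\<forall>\<^sub>F R in at_top. ereal (- b R / 2 / n R) = lattice_mean_energy sticky_potential t R"
    using eventually_gt_at_top[of 0]
    by eventually_elim (simp add: lattice_mean_energy_eq_bond_count[OF t] b_def n_def)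
  ultimately show ?thesis
    unfolding D_def by (rule Lim_transform_eventually)
qed

lemma lattice_mean_energy_tendsto_infty:
  assumes t: "0 < t" "t < 1"
  shows "(lattice_mean_energy sticky_potential t \<longlongrightarrow> \<infinity>) at_top"
proof (rule tendsto_eventually)
  show "\<forall>\<^sub>F R in at_top. lattice_mean_energy sticky_potential t R = \<infinity>"
    using eventually_gt_at_top[of 1]
  proof eventually_elim
    fix R :: real assume R: "1 < R"
    have n: "norm (lattice_point t (1, 0)) = t" "norm (lattice_point t 0) = 0"
      using t by (simp_all add: norm_lattice_point)
    then have mem: "(0, 0) \<in> lattice_disc t R" "(1, 0) \<in> lattice_disc t R"
      using R t by (auto simp: lattice_disc_def zero_prod_def)
    have "dist (lattice_point t (1, 0)) (lattice_point t (0, 0)) = t"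
      using n by (simp add: dist_norm lattice_point_diff)
    with mem t have "\<not> separated (lattice_point t ` lattice_disc t R)"
      unfolding separated_def by (metis dist_self imageI less_irrefl not_le)
    then have "energy sticky_potential (lattice_point t ` lattice_disc t R) = \<infinity>"
      using finite_lattice_disc[OF t(1)] by (intro energy_not_separated) auto
    then show "lattice_mean_energy sticky_potential t R = \<infinity>"
      by (simp add: lattice_mean_energy_def square_lattice_ball)
  qed
qed

lemma lattice_energy_eq:
  assumes "0 < t"
  shows "lattice_energy sticky_potential t
       = (if t < 1 then \<infinity> else ereal (- real (card (bond_directions t)) / 2))"
  unfolding lattice_energy_def
  using tendsto_Lim[OF _ lattice_mean_energy_tendsto] tendsto_Lim[OF _ lattice_mean_energy_tendsto_infty]
    assms by simp

lemma lattice_energy_1: "lattice_energy sticky_potential 1 = -4"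
  by (simp add: lattice_energy_eq card_bond_directions_1)

lemma sq_energy_eq: "sq_energy sticky_potential = -4"
  unfolding sq_energy_def
proof (rule antisym)
  show "(INF t\<in>{0<..}. lattice_energy sticky_potential t) \<le> -4"
    by (rule INF_lower2[of 1]) (auto simp: lattice_energy_1)
  show "-4 \<le> (INF t\<in>{0<..}. lattice_energy sticky_potential t)"
  proof (rule INF_greatest)
    fix t :: real assume "t \<in> {0<..}"
    then show "-4 \<le> lattice_energy sticky_potential t"
      using card_bond_directions_le[of t] by (auto simp: lattice_energy_eq)
  qed
qed

section \<open>The ground state energy from above\<close>

text \<open>
  The competitor is the square of \<open>n * n\<close> lattice points with \<open>n = \<lfloor>sqrt N\<rfloor>\<close>, completed by
  arbitrary lattice points. Of the error, \<open>16 n + 4\<close> comes from the bonds lost at the boundary of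
  the square and \<open>4 * (2 n + 1)\<close> from the points outside of it, of which there are at most
  \<open>2 n + 1\<close>.
\<close>

lemma ground_energy_le:
  "ground_energy sticky_potential N \<le> ereal (- 4 * real N + (24 * sqrt (real N) + 8))"
proof -
  define n where "n = nat \<lfloor>sqrt (real N)\<rfloor>"
  have n1: "real n \<le> sqrt (real N)" and n2: "sqrt (real N) < real n + 1"
    unfolding n_def using of_nat_floor by auto
  have "real (n * n) \<le> real N"
    using mult_mono[OF n1 n1] by simp
  then have nN: "n * n \<le> N"
    by (simp only: of_nat_le_iff)
  have "sqrt (real N) * sqrt (real N) < (real n + 1) * (real n + 1)"
    using n2 by (intro mult_strict_mono) auto
  then have "real N \<le> real n * real n + 2 * real n + 1"
    by (simp add: algebra_simps)
  define A where "A = {0..int n - 1} \<times> {0..int n - 1}"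
  have finA: "finite A" and cardA: "card A = n * n"
    by (auto simp: A_def card_cartesian_product)
  obtain C where C: "C \<subseteq> UNIV - A" "finite C" "card C = N - n * n"
    using infinite_arbitrarily_large[of "UNIV - A" "N - n * n"] finA
    by (metis Diff_infinite_finite finite_prod infinite_UNIV_int)
  define B where "B = A \<union> C"
  have B: "A \<subseteq> B" "finite B" "card B = N"
    using C finA cardA nN card_Un_disjoint[of A C] by (auto simp: B_def)
  have convA: "line_convex A"
  proof -
    have "convex (cbox 0 (vector [of_int (int n - 1), of_int (int n - 1)] :: real^2))"
      by (rule convex_box)
    moreover have "A = {p. lattice_point 1 p \<in> cbox 0 (vector [of_int (int n - 1), of_int (int n - 1)])}"
      by (auto simp: A_def lattice_point_def mem_box_cart forall_2 simp del: of_int_diff)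
    ultimately show ?thesis
      using line_convex_preimage by metis
  qed
  have "8 * (real n * real n - (4 * real n + 1))
      \<le> (\<Sum>p\<in>A. real (card {d \<in> bond_directions 1. p + d \<in> A}))"
    using bond_count_ge[OF order_refl _ convA, of "int n"] cardA
    by (simp add: card_bond_directions_1) (force simp: A_def)
  also have "\<dots> \<le> (\<Sum>p\<in>A. real (card {d \<in> bond_directions 1. p + d \<in> B}))"
    using B(1) by (intro sum_mono) (auto intro!: card_mono finite_subset[OF _ finite_bond_directions[OF order_refl]])
  also have "\<dots> \<le> (\<Sum>p\<in>B. real (card {d \<in> bond_directions 1. p + d \<in> B}))"
    using B by (intro sum_mono2) auto
  finally have "energy sticky_potential (lattice_point 1 ` B) \<le> ereal (- 4 * (real n * real n - (4 * real n + 1)))"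
    using energy_lattice[OF order_refl B(2)] by simp
  moreover have "ground_energy sticky_potential N \<le> energy sticky_potential (lattice_point 1 ` B)"
    unfolding ground_energy_def
    by (rule INF_lower) (use B inj_lattice_point[of 1] in \<open>auto simp: card_image inj_on_subset\<close>)
  moreover have "- 4 * (real n * real n - (4 * real n + 1)) \<le> - 4 * real N + (24 * sqrt (real N) + 8)"
    using n1 \<open>real N \<le> real n * real n + 2 * real n + 1\<close> by (simp add: algebra_simps)
  ultimately show ?thesis
    by (meson ereal_less_eq(3) order_trans)
qed

theorem theorem1p1:
  shows "(\<forall>N. \<exists>X. finite X \<and> card X = N \<and>
             energy sticky_potential X = ground_energy sticky_potential N) \<and>
         (\<forall>t>0. \<exists>l. (lattice_mean_energy sticky_potential t \<longlongrightarrow> l) at_top) \<and>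
         (\<exists>t>0. lattice_energy sticky_potential t = sq_energy sticky_potential) \<and>
         sq_energy sticky_potential = -4 \<and>
         (\<forall>N::nat. ereal (real N) * sq_energy sticky_potential \<le> ground_energy sticky_potential N) \<and>
         (\<exists>f :: nat \<Rightarrow> real. f \<in> O(\<lambda>N. sqrt (real N)) \<and>
           (\<forall>N. ground_energy sticky_potential N
                  \<le> ereal (real N) * sq_energy sticky_potential + ereal (f N)))"
proof (intro conjI allI impI)
  fix N
  show "\<exists>X. finite X \<and> card X = N \<and> energy sticky_potential X = ground_energy sticky_potential N"
    by (rule ground_energy_attained)
next
  fix t :: real assume "t > 0"
  then show "\<exists>l. (lattice_mean_energy sticky_potential t \<longlongrightarrow> l) at_top"
    using lattice_mean_energy_tendsto lattice_mean_energy_tendsto_infty by (meson not_le)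
next
  show "\<exists>t>0. lattice_energy sticky_potential t = sq_energy sticky_potential"
    by (rule exI[of _ 1]) (simp add: lattice_energy_1 sq_energy_eq)
next
  show "sq_energy sticky_potential = -4"
    by (rule sq_energy_eq)
next
  fix N :: nat
  show "ereal (real N) * sq_energy sticky_potential \<le> ground_energy sticky_potential N"
    using ground_energy_ge[of N] by (simp add: sq_energy_eq mult.commute)
next
  show "\<exists>f :: nat \<Rightarrow> real. f \<in> O(\<lambda>N. sqrt (real N)) \<and>
           (\<forall>N. ground_energy sticky_potential N
                  \<le> ereal (real N) * sq_energy sticky_potential + ereal (f N))"
  proof (intro exI[of _ "\<lambda>N. 24 * sqrt (real N) + 8"] conjI allI)
    show "(\<lambda>N. 24 * sqrt (real N) + 8) \<in> O(\<lambda>N. sqrt (real N))"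
      by real_asymp
    fix N
    show "ground_energy sticky_potential N
        \<le> ereal (real N) * sq_energy sticky_potential + ereal (24 * sqrt (real N) + 8)"
      using ground_energy_le[of N] by (simp add: sq_energy_eq mult.commute)
  qed
qed

end
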